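(* For any $\lambda\ge1$ there exist weighted simple $n$-node graphs (equivalently, unweighted multigraphs) $G=(V,E)$ with edge connectivity at least $\lambda$ and diameter $D=O(\log n)$, with two distinguished nodes $s,t\in V$, such that sending $K$ bits of information from $s$ to $t$ requires at least $\Omega\big(\min\{\frac{K}{B\log n},\,n\}\big)$ rounds. For unweighted simple graphs, there exist $n$-node graphs with edge connectivity at least $\lambda$ and diameter $O(\log n)$, with two distinguished nodes $s,t$, for which the same problem requires $\Omega\big(\min\{\frac{K}{B\log n},\,\frac{n}{\lambda}\}\big)$ rounds.
   Context: Model: synchronous rounds on a weighted network with all weights at least $1$, where in each round $B\cdot w(e)$ bits can be sent over each edge $e$ (for unweighted graphs, $B$ bits per edge). Sending $K$ bits from $s$ to $t$ is the distributed task in which $s$ receives an arbitrary $K$-bit string as input, all other nodes receive the empty input, and $t$ must output $s$'s input string (the other nodes output the empty string); protocols may be randomized with constant error probability. Edge connectivity is the minimum total weight of edges crossing a nonempty proper vertex subset; diameter is the unweighted (hop) diameter. *)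

theory Defs
  imports "HOL-Probability.Probability"
begin

definition simple_graph :: "'v set \<Rightarrow> 'v set set \<Rightarrow> bool" where
  "simple_graph V E \<longleftrightarrow> finite V \<and> (\<forall>e\<in>E. e \<subseteq> V \<and> card e = 2)"

definition cut_weight :: "'v set set \<Rightarrow> ('v set \<Rightarrow> real) \<Rightarrow> 'v set \<Rightarrow> real" where
  "cut_weight E w S = (\<Sum>e | e \<in> E \<and> e \<inter> S \<noteq> {} \<and> e - S \<noteq> {}. w e)"

(* Meaningful for finite V with at least two nodes, where the minimum is over a nonempty set. *)
definition edge_connectivity :: "'v set \<Rightarrow> 'v set set \<Rightarrow> ('v set \<Rightarrow> real) \<Rightarrow> real" where
  "edge_connectivity V E w = Min (cut_weight E w ` {S. S \<noteq> {} \<and> S \<subset> V})"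

(* The hop distance is infinite between different components. *)
definition hop_dist :: "'v set set \<Rightarrow> 'v \<Rightarrow> 'v \<Rightarrow> enat" where
  "hop_dist E u v = Inf (enat ` {k. (u, v) \<in> {(x, y). {x, y} \<in> E} ^^ k})"

definition hop_diameter :: "'v set \<Rightarrow> 'v set set \<Rightarrow> enat" where
  "hop_diameter V E = (SUP u\<in>V. SUP v\<in>V. hop_dist E u v)"

(* Local computation is unrestricted, so instead of an explicit state a node keeps its whole view:
   its input, its random string, and the list of messages received so far, one entry per round,
   mapping each neighbour to the message that came from it.  A protocol may depend on the
   identity of the node and on the network, i.e. the topology is known to all nodes. *)

type_synonym bits = "bool list"
type_synonym coins = "nat \<Rightarrow> bool"
type_synonym 'v history = "('v \<Rightarrow> bits) list"

(* msg P v i c h u is what v, with input i, random string c and history h, sends next to u. *)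
record 'v protocol =
  msg :: "'v \<Rightarrow> bits \<Rightarrow> coins \<Rightarrow> 'v history \<Rightarrow> 'v \<Rightarrow> bits"
  out :: "'v \<Rightarrow> bits \<Rightarrow> coins \<Rightarrow> 'v history \<Rightarrow> bits"

primrec history ::
    "'v set set \<Rightarrow> 'v protocol \<Rightarrow> ('v \<Rightarrow> bits) \<Rightarrow> ('v \<Rightarrow> coins) \<Rightarrow> nat \<Rightarrow> 'v \<Rightarrow> 'v history" where
  "history E P inp \<omega> 0 = (\<lambda>v. [])"
| "history E P inp \<omega> (Suc r) =
     (\<lambda>v. history E P inp \<omega> r v @
        [\<lambda>u. if {u, v} \<in> E then msg P u (inp u) (\<omega> u) (history E P inp \<omega> r u) v else []])"

definition node_output ::
    "'v set set \<Rightarrow> 'v protocol \<Rightarrow> ('v \<Rightarrow> bits) \<Rightarrow> ('v \<Rightarrow> coins) \<Rightarrow> nat \<Rightarrow> 'v \<Rightarrow> bits" where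
  "node_output E P inp \<omega> r v = out P v (inp v) (\<omega> v) (history E P inp \<omega> r v)"

(* The bound is per direction of an edge; shorter messages, including none at all, are allowed. *)
definition respects_bandwidth ::
    "'v set set \<Rightarrow> ('v set \<Rightarrow> real) \<Rightarrow> nat \<Rightarrow> 'v protocol \<Rightarrow> bool" where
  "respects_bandwidth E w B P \<longleftrightarrow>
     (\<forall>u v i c h. {u, v} \<in> E \<longrightarrow> real (length (msg P u i c h v)) \<le> real B * w {u, v})"

definition source_input :: "'v \<Rightarrow> bits \<Rightarrow> 'v \<Rightarrow> bits" where
  "source_input s x = (\<lambda>v. if v = s then x else [])"

(* R is the joint distribution of the random strings of the nodes.  It is arbitrary, so both
   independent private coins and shared randomness are covered.  Since the measure of a
   nonmeasurable set is 0, the condition with \<epsilon> < 1 makes the success event measurable. *)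
definition sends_string ::
    "'v set \<Rightarrow> 'v set set \<Rightarrow> 'v \<Rightarrow> 'v \<Rightarrow> nat \<Rightarrow> real \<Rightarrow> ('v \<Rightarrow> coins) measure \<Rightarrow> 'v protocol \<Rightarrow> nat \<Rightarrow> bool"
    where
  "sends_string V E s t K \<epsilon> R P r \<longleftrightarrow>
     (\<forall>x. length x = K \<longrightarrow>
        measure R {\<omega> \<in> space R. \<forall>v\<in>V. node_output E P (source_input s x) \<omega> r v = (if v = t then x else [])}
          \<ge> 1 - \<epsilon>)"

definition sending_requires_rounds ::
    "'v set \<Rightarrow> 'v set set \<Rightarrow> ('v set \<Rightarrow> real) \<Rightarrow> 'v \<Rightarrow> 'v \<Rightarrow> nat \<Rightarrow> nat \<Rightarrow> real \<Rightarrow> real \<Rightarrow> bool" where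
  "sending_requires_rounds V E w s t B K \<epsilon> L \<longleftrightarrow>
     (\<forall>R P r. prob_space R \<and> respects_bandwidth E w B P \<and> sends_string V E s t K \<epsilon> R P r
        \<longrightarrow> L \<le> real r)"

(* The K and \<epsilon> for which outputting a fixed or random guess, with success probability at most
   1/2^K on some input, does not suffice.  For \<epsilon> < 1/2 these are all K > 0, and for every
   \<epsilon> < 1 all sufficiently large K.  For all other K no round is needed. *)
definition beats_guessing :: "nat \<Rightarrow> real \<Rightarrow> bool" where
  "beats_guessing K \<epsilon> \<longleftrightarrow> 1 - \<epsilon> > 1 / 2 ^ K"

end

theory Submission
  imports Defs
begin

text \<open>
  On the nodes \<open>0, \<dots>, n - 1\<close> join any two at distance at most \<open>L\<close>, and add the
  shortcuts from \<open>a 2\<^sup>k\<close> to \<open>(a + 1) 2\<^sup>k\<close>.  Clearing the bits of a node one at a time leads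
  to \<open>0\<close> in \<open>O(log n)\<close> hops.  Every cut splits two consecutive nodes, hence a clique of
  \<open>L + 1\<close> consecutive nodes.  For the weighted graph take \<open>L = 1\<close> and give the path edges weight
  \<open>\<lceil>\<lambda>\<rceil>\<close>, for the unweighted one take \<open>L = \<lceil>\<lambda>\<rceil>\<close>.

  Let \<open>s = 0\<close> and \<open>t = n - 1\<close>.  Short edges carry information by at most \<open>L\<close> positions per
  round, so what the nodes beyond \<open>r L\<close> know after \<open>r\<close> rounds depends on the input only through
  the shortcut messages that jumped the moving frontier: at most one of \<open>B\<close> bits for each level
  and round.  If \<open>T L < n - 1\<close>, then for fixed coins \<open>t\<close> is therefore correct on at most
  \<open>2\<close> to the power \<open>O(T B log n)\<close> inputs, whereas on average over the coins it is correct on at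
  least \<open>(1 - \<epsilon>) 2\<^sup>K\<close> of them.
\<close>

section \<open>The network and its basic properties\<close>

definition dyadic_net :: "nat \<Rightarrow> nat \<Rightarrow> nat set set" where
  "dyadic_net n L = {{u, v} | u v. u < v \<and> v < n \<and>
     (v - u \<le> L \<or> (\<exists>k a. u = a * 2 ^ k \<and> v = (a + 1) * 2 ^ k))}"

lemma dyadic_net_iff:
  assumes "u < v"
  shows "{u, v} \<in> dyadic_net n L \<longleftrightarrow>
    v < n \<and> (v - u \<le> L \<or> (\<exists>k a. u = a * 2 ^ k \<and> v = (a + 1) * 2 ^ k))"
  using assms by (auto simp: dyadic_net_def doubleton_eq_iff)

lemma simple_graph_dyadic_net: "simple_graph {..<n} (dyadic_net n L)"
  by (auto simp: simple_graph_def dyadic_net_def)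

lemma finite_dyadic_net: "finite (dyadic_net n L)"
proof (rule finite_subset)
  show "dyadic_net n L \<subseteq> Pow {..<n}"
    by (auto simp: dyadic_net_def)
qed simp

subsection \<open>Edge connectivity\<close>

lemma exists_split_consecutive:
  fixes S :: "nat set"
  assumes "S \<noteq> {}" "S \<subset> {..<n}"
  shows "\<exists>u. Suc u < n \<and> (u \<in> S \<longleftrightarrow> Suc u \<notin> S)"
proof (rule ccontr)
  assume "\<not> ?thesis"
  then have step: "Suc u < n \<Longrightarrow> u \<in> S \<longleftrightarrow> Suc u \<in> S" for u
    by blast
  have "v < n \<Longrightarrow> v \<in> S \<longleftrightarrow> 0 \<in> S" for v
    by (induction v) (use step in auto)
  with assms show False
    by blast
qed

text \<open>This is \<open>(a - 1) * (b - 1) \<ge> 0\<close> expanded: splitting a clique into parts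
  of sizes \<open>a\<close> and \<open>b\<close> cuts at least \<open>a + b - 1\<close>
  edges.\<close>

lemma add_le_mult_plus_one:
  fixes a b :: nat
  assumes "a \<ge> 1" "b \<ge> 1"
  shows "a + b \<le> a * b + 1"
proof -
  obtain a' b' where "a = Suc a'" "b = Suc b'"
    using assms by (metis One_nat_def Suc_le_D)
  then show ?thesis
    by simp
qed

lemma cut_weight_dyadic_net:
  assumes L: "L \<ge> 1" "L + 1 \<le> n" and S: "S \<noteq> {}" "S \<subset> {..<n}"
    and near: "\<And>u v. u < v \<Longrightarrow> v - u \<le> L \<Longrightarrow> w {u, v} \<ge> c"
    and pos: "\<And>e. w e \<ge> 0" and c: "c \<ge> 0"
  shows "cut_weight (dyadic_net n L) w S \<ge> real L * c"
proof -
  obtain u where u: "Suc u < n" "u \<in> S \<longleftrightarrow> Suc u \<notin> S"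
    using exists_split_consecutive[OF S] by blast
  \<comment> \<open>The window of \<open>L + 1\<close> nodes starts at \<open>u\<close>, or is
    shifted left to end at \<open>n - 1\<close> if it would overrun. Either way it contains the
    split pair \<open>u\<close>, \<open>Suc u\<close>, so \<open>S\<close> cuts this clique
    properly.\<close>
  define j where "j = min u (n - L - 1)"
  define I where "I = {j..j + L}"
  have I: "u \<in> I" "Suc u \<in> I" "I \<subseteq> {..<n}" "card I = L + 1"
    using u L by (auto simp: I_def j_def)
  have finI: "finite I"
    by (simp add: I_def)
  let ?A = "I \<inter> S" and ?B = "I - S"
  have ne: "?A \<noteq> {}" "?B \<noteq> {}"
    using I u by auto
  have cardAB: "card ?A + card ?B = L + 1"
    using I(4) finI by (metis Int_Diff_Un Int_Diff_disjoint card_Un_disjoint finite_Diff finite_Int)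
  have "card ?A \<ge> 1" "card ?B \<ge> 1"
    using ne finI by (simp_all add: Suc_le_eq card_gt_0_iff)
  then have L_le: "L \<le> card ?A * card ?B"
    using cardAB add_le_mult_plus_one[of "card ?A" "card ?B"] by linarith
  let ?F = "(\<lambda>(a, b). {a, b}) ` (?A \<times> ?B)"
  have inj: "inj_on (\<lambda>(a, b). {a, b}) (?A \<times> ?B)"
    by (auto simp: inj_on_def doubleton_eq_iff)
  then have cardF: "card ?F = card ?A * card ?B"
    by (simp add: card_image card_cartesian_product)
  have edge: "{a, b} \<in> dyadic_net n L \<and> w {a, b} \<ge> c" if "a \<in> ?A" "b \<in> ?B" for a b
  proof -
    have *: "{x, y} \<in> dyadic_net n L \<and> w {x, y} \<ge> c" if "x < y" "x \<in> I" "y \<in> I" for x y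
    proof -
      have "y < n"
        using that(3) I(3) by blast
      moreover have "y - x \<le> L"
        using that by (auto simp: I_def)
      ultimately show ?thesis
        using that near by (simp add: dyadic_net_iff)
    qed
    have "a \<noteq> b"
      using that by auto
    then show ?thesis
      using *[of a b] *[of b a] that by (cases "a < b") (auto simp: insert_commute)
  qed
  have "real L * c \<le> real (card ?F) * c"
    using L_le c unfolding cardF by (intro mult_right_mono of_nat_mono)
  also have "\<dots> = (\<Sum>e\<in>?F. c)"
    by simp
  also have "\<dots> \<le> (\<Sum>e\<in>?F. w e)"
    using edge by (intro sum_mono) auto
  also have "\<dots> \<le> cut_weight (dyadic_net n L) w S"
    unfolding cut_weight_def
    by (rule sum_mono2) (use edge pos finite_dyadic_net in auto)
  finally show ?thesis .
qed

lemma edge_connectivity_dyadic_net: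
  assumes "L \<ge> 1" "L + 1 \<le> n"
    and "\<And>u v. u < v \<Longrightarrow> v - u \<le> L \<Longrightarrow> w {u, v} \<ge> c"
    and "\<And>e. w e \<ge> 0" and "c \<ge> 0"
  shows "edge_connectivity {..<n} (dyadic_net n L) w \<ge> real L * c"
proof -
  have fin: "finite {S. S \<noteq> {} \<and> S \<subset> {..<n}}"
    by (rule finite_subset[of _ "Pow {..<n}"]) auto
  have "{0} \<in> {S. S \<noteq> {} \<and> S \<subset> {..<n}}"
    using assms(1,2) by (auto simp: psubset_eq dest!: equalityD2 subsetD[where c = 1])
  then have "{S. S \<noteq> {} \<and> S \<subset> {..<n}} \<noteq> {}"
    by blast
  moreover have "real L * c \<le> cut_weight (dyadic_net n L) w S" if "S \<noteq> {}" "S \<subset> {..<n}" for S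
    using assms(1,2) that assms(3-5) by (rule cut_weight_dyadic_net)
  ultimately show ?thesis
    unfolding edge_connectivity_def using fin by (subst Min_ge_iff) auto
qed

subsection \<open>Diameter\<close>

text \<open>An even \<open>v\<close> at scale \<open>2\<^sup>j\<close> is \<open>v div 2\<close> at scale \<open>2\<^sup>j\<^sup>+\<^sup>1\<close>; an odd one becomes even by one edge of level \<open>j\<close>.\<close>

lemma dyadic_net_path_to_0:
  assumes "v < 2 ^ m" "v * 2 ^ j < n"
  shows "\<exists>k\<le>m. (v * 2 ^ j, 0) \<in> {(x, y). {x, y} \<in> dyadic_net n L} ^^ k"
  using assms
proof (induction m arbitrary: v j)
  case 0
  then show ?case
    by simp
next
  case (Suc m)
  let ?R = "{(x, y). {x, y} \<in> dyadic_net n L}"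
  define q where "q = v div 2"
  have q_eq: "q * 2 ^ Suc j = (2 * q) * 2 ^ j"
    by simp
  have "q < 2 ^ m"
    using Suc.prems by (auto simp: q_def)
  moreover have "2 * q * 2 ^ j \<le> v * 2 ^ j"
    by (intro mult_right_mono) (auto simp: q_def)
  then have "q * 2 ^ Suc j < n"
    using Suc.prems(2) unfolding q_eq by linarith
  ultimately obtain k where k: "k \<le> m" "((2 * q) * 2 ^ j, 0) \<in> ?R ^^ k"
    using Suc.IH[of q "Suc j"] unfolding q_eq by blast
  show ?case
  proof (cases "even v")
    case True
    then have "v = 2 * q"
      by (simp add: q_def)
    with k show ?thesis
      by (auto intro: le_SucI)
  next
    case False
    then have v: "v = 2 * q + 1"
      by (simp add: q_def)
    have "{2 * q * 2 ^ j, v * 2 ^ j} \<in> dyadic_net n L"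
      using Suc.prems(2) unfolding v by (subst dyadic_net_iff) auto
    then have "(v * 2 ^ j, 2 * q * 2 ^ j) \<in> ?R"
      by (simp add: insert_commute)
    then have "(v * 2 ^ j, 0) \<in> ?R ^^ Suc k"
      using k(2) by (rule relpow_Suc_I2)
    with k(1) show ?thesis
      by blast
  qed
qed

lemma sym_relpow:
  assumes "sym R"
  shows "sym (R ^^ k)"
proof (induction k)
  case (Suc k)
  show ?case
  proof (rule symI)
    fix x z
    assume "(x, z) \<in> R ^^ Suc k"
    then obtain y where y: "(x, y) \<in> R ^^ k" "(y, z) \<in> R"
      by (rule relpow_Suc_E)
    have "(z, y) \<in> R" "(y, x) \<in> R ^^ k"
      using assms y(2) Suc y(1) by (auto elim: symE)
    then show "(z, x) \<in> R ^^ Suc k"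
      by (rule relpow_Suc_I2)
  qed
qed (simp add: sym_Id)

lemma hop_dist_le: "(u, v) \<in> {(x, y). {x, y} \<in> E} ^^ k \<Longrightarrow> hop_dist E u v \<le> enat k"
  unfolding hop_dist_def by (rule Inf_lower) auto

text \<open>Any two nodes are joined through \<open>0\<close>, at most \<open>m\<close> hops on each
  side.\<close>

lemma hop_diameter_dyadic_net:
  assumes "n \<le> 2 ^ m"
  shows "hop_diameter {..<n} (dyadic_net n L) \<le> enat (2 * m)"
proof -
  let ?R = "{(x, y). {x, y} \<in> dyadic_net n L}"
  have "hop_dist (dyadic_net n L) u v \<le> enat (2 * m)" if uv: "u < n" "v < n" for u v
  proof -
    have less: "u < 2 ^ m" "v < 2 ^ m"
      using uv assms by linarith+
    obtain k where k: "k \<le> m" "(u, 0) \<in> ?R ^^ k"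
      using dyadic_net_path_to_0[of u m 0 n L] uv less by auto
    obtain l where l: "l \<le> m" "(v, 0) \<in> ?R ^^ l"
      using dyadic_net_path_to_0[of v m 0 n L] uv less by auto
    have "sym ?R"
      by (auto simp: sym_def insert_commute)
    then have "sym (?R ^^ l)"
      by (rule sym_relpow)
    then have "(0, v) \<in> ?R ^^ l"
      using l(2) by (rule symD)
    with k(2) have "(u, v) \<in> ?R ^^ (k + l)"
      by (auto simp: relpow_add)
    then have "hop_dist (dyadic_net n L) u v \<le> enat (k + l)"
      by (rule hop_dist_le)
    also have "\<dots> \<le> enat (2 * m)"
      using k(1) l(1) by simp
    finally show ?thesis .
  qed
  then show ?thesis
    unfolding hop_diameter_def by (auto intro!: SUP_least)
qed

subsection \<open>Information reaching the far end\<close>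

text \<open>The only dyadic edge of level \<open>k\<close> that leads from a node \<open>\<le> r L\<close> to a node \<open>> r L\<close>
  starts at \<open>(r L div 2\<^sup>k) 2\<^sup>k\<close>.\<close>

definition crossing_msg ::
    "nat \<Rightarrow> nat \<Rightarrow> nat protocol \<Rightarrow> (nat \<Rightarrow> coins) \<Rightarrow> bits \<Rightarrow> nat \<Rightarrow> nat \<Rightarrow> bits" where
  "crossing_msg n L P \<omega> x r k =
     (let u = (r * L div 2 ^ k) * 2 ^ k; v = u + 2 ^ k
      in if {u, v} \<in> dyadic_net n L \<and> v - u > L
         then msg P u (source_input 0 x u) (\<omega> u)
                (history (dyadic_net n L) P (source_input 0 x) \<omega> r u) v
         else [])"

text \<open>Induction on the round, with frontier \<open>r * L\<close>. A sender beyond the frontier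
  has the same view for \<open>x\<close> and \<open>y\<close>; a sender at or before it can reach a
  node beyond the next frontier only by a shortcut, whose message is one of the
  \<open>crossing_msg\<close>.\<close>

lemma history_determined_by_crossing_msgs:
  assumes n: "n \<le> 2 ^ m"
    and eq: "\<And>r k. r < T \<Longrightarrow> k < m \<Longrightarrow> crossing_msg n L P \<omega> x r k = crossing_msg n L P \<omega> y r k"
    and "r \<le> T" "v \<ge> r * L + 1"
  shows "history (dyadic_net n L) P (source_input 0 x) \<omega> r v =
         history (dyadic_net n L) P (source_input 0 y) \<omega> r v"
  using assms(3,4)
proof (induction r arbitrary: v)
  case 0
  then show ?case
    by simp
next
  case (Suc r)
  let ?E = "dyadic_net n L"
  let ?m = "\<lambda>x u. msg P u (source_input 0 x u) (\<omega> u) (history ?E P (source_input 0 x) \<omega> r u) v"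
  have "?m x u = ?m y u" if e: "{u, v} \<in> ?E" for u
  \<comment> \<open>In the first case \<open>u\<close> is not the source \<open>0\<close>, so its
    input is empty for both strings and its history agrees by induction.\<close>
  proof (cases "u \<ge> r * L + 1")
    case True
    then show ?thesis
      using Suc.IH[of u] Suc.prems(1) by (simp add: source_input_def)
  next
    case False
    then have far: "u < v" "v - u > L"
      using Suc.prems(2) by auto
    then obtain k a where ka: "u = a * 2 ^ k" "v = (a + 1) * 2 ^ k"
      using e by (auto simp: dyadic_net_iff)
    have "v < n"
      using e far by (simp add: dyadic_net_iff)
    \<comment> \<open>The frontier lies in the dyadic interval from \<open>u\<close> up to but
      excluding \<open>v\<close>, so the level \<open>k\<close> alone determines the edge.\<close>
    have "a = r * L div 2 ^ k"
    proof (rule sym, rule div_nat_eqI)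
      show "2 ^ k * a \<le> r * L"
        using False ka by (simp add: mult.commute)
      show "r * L < 2 ^ k * Suc a"
        using Suc.prems(2) ka by (simp add: mult.commute)
    qed
    then have u: "u = (r * L div 2 ^ k) * 2 ^ k" and v: "v = u + 2 ^ k"
      using ka by simp_all
    have "2 ^ k < (2::nat) ^ m"
      using n \<open>v < n\<close> v by linarith
    then have "k < m"
      by simp
    then have "crossing_msg n L P \<omega> x r k = crossing_msg n L P \<omega> y r k"
      using eq Suc.prems(1) by simp
    moreover have "crossing_msg n L P \<omega> z r k = ?m z u" for z
      using e far unfolding crossing_msg_def Let_def u[symmetric] v[symmetric] by simp
    ultimately show ?thesis
      by simp
  qed
  then show ?case
    using Suc.IH[of v] Suc.prems by auto
qed

lemma finite_bits_le: "finite {b :: bits. length b \<le> B}"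
  using finite_lists_length_le[of "UNIV :: bool set" B] by simp

text \<open>Silence and shorter messages also count, giving fewer than \<open>2 ^ (B + 1)\<close>
  possibilities; \<open>B \<ge> 1\<close> turns this into a pure power with exponent proportional to
  \<open>B\<close>.\<close>

lemma card_bits_le:
  assumes "B \<ge> 1"
  shows "card {b :: bits. length b \<le> B} \<le> 4 ^ B"
proof -
  have "card {b :: bits. length b \<le> B} = (\<Sum>i\<le>B. 2 ^ i)"
    using card_lists_length_le[of "UNIV :: bool set" B] by simp
  also have "\<dots> \<le> (2::nat) ^ Suc B"
    using sum_power2[of "Suc B"] by (simp add: lessThan_Suc_atMost atLeast0LessThan)
  also have "\<dots> \<le> 2 ^ (2 * B)"
    using assms by (intro power_increasing) auto
  finally show ?thesis
    by (simp add: power_mult)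
qed

text \<open>With the coins fixed, the table of crossing messages determines the view of
  \<open>n - 1\<close> and hence its output, so correctly decoded inputs have distinct tables. A
  table has \<open>T * m\<close> entries of at most \<open>B\<close> bits each, since long edges
  have weight at most \<open>1\<close>.\<close>

lemma card_decodable_inputs:
  assumes n: "n \<le> 2 ^ m" and T: "T * L + 1 \<le> n - 1" and B: "B \<ge> 1"
    and bw: "respects_bandwidth (dyadic_net n L) w B P"
    and far: "\<And>u v. u < v \<Longrightarrow> v - u > L \<Longrightarrow> w {u, v} \<le> 1"
  shows "card {x. length x = K \<and>
                 node_output (dyadic_net n L) P (source_input 0 x) \<omega> T (n - 1) = x}
           \<le> 4 ^ (B * (T * m))" (is "card ?G \<le> _")
proof -
  let ?D = "{..<T} \<times> {..<m}"
  let ?M = "\<lambda>x. \<lambda>(r, k)\<in>?D. crossing_msg n L P \<omega> x r k"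
  have len: "length (crossing_msg n L P \<omega> x r k) \<le> B" for x r k
  proof -
    define u where "u = (r * L div 2 ^ k) * 2 ^ k"
    have "length (msg P u i c h (u + 2 ^ k)) \<le> B"
      if "{u, u + 2 ^ k} \<in> dyadic_net n L" "2 ^ k > L" for i c h
    proof -
      have "real (length (msg P u i c h (u + 2 ^ k))) \<le> real B * w {u, u + 2 ^ k}"
        using bw that(1) by (auto simp: respects_bandwidth_def)
      also have "\<dots> \<le> real B * 1"
        using that(2) by (intro mult_left_mono far) auto
      finally show ?thesis
        by simp
    qed
    then show ?thesis
      by (simp add: crossing_msg_def Let_def flip: u_def)
  qed
  have "inj_on ?M ?G"
  proof (rule inj_onI)
    fix x y
    assume xy: "x \<in> ?G" "y \<in> ?G" and M: "?M x = ?M y"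
    have "crossing_msg n L P \<omega> x r k = crossing_msg n L P \<omega> y r k" if "r < T" "k < m" for r k
      using fun_cong[OF M, of "(r, k)"] that by simp
    then have "history (dyadic_net n L) P (source_input 0 x) \<omega> T (n - 1) =
               history (dyadic_net n L) P (source_input 0 y) \<omega> T (n - 1)"
      using n T by (intro history_determined_by_crossing_msgs[where T = T and m = m]) auto
    \<comment> \<open>The bound on \<open>T\<close> forces \<open>n - 1 \<ge> 1\<close>, so the
      receiver differs from the source and its own input is empty.\<close>
    moreover have "source_input 0 x (n - 1) = source_input 0 y (n - 1)"
      using T unfolding source_input_def by auto
    ultimately show "x = y"
      using xy by (simp add: node_output_def)
  qed
  moreover have "?M ` ?G \<subseteq> ?D \<rightarrow>\<^sub>E {b. length b \<le> B}"
    using len by (auto simp: PiE_def extensional_def)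
  moreover have fin: "finite (?D \<rightarrow>\<^sub>E {b :: bits. length b \<le> B})"
    by (intro finite_PiE finite_bits_le) auto
  ultimately have "card ?G \<le> card (?D \<rightarrow>\<^sub>E {b :: bits. length b \<le> B})"
    by (rule card_inj_on_le)
  also have "\<dots> = card {b :: bits. length b \<le> B} ^ (T * m)"
    by (subst card_PiE) (auto simp: card_cartesian_product)
  also have "\<dots> \<le> (4 ^ B) ^ (T * m)"
    using card_bits_le[OF B] by (rule power_mono) simp
  finally show ?thesis
    by (simp add: power_mult)
qed

subsection \<open>The round lower bound\<close>

text \<open>By linearity, the sum is the expected number of the events that occur, and this number
  never exceeds \<open>N\<close>.\<close>

lemma (in prob_space) sum_prob_le_if_multiplicity_le:
  assumes X: "finite X" and ev: "\<And>x. x \<in> X \<Longrightarrow> A x \<in> events"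
    and mult: "\<And>\<omega>. \<omega> \<in> space M \<Longrightarrow> card {x \<in> X. \<omega> \<in> A x} \<le> N"
  shows "(\<Sum>x\<in>X. prob (A x)) \<le> real N"
proof -
  have "(\<Sum>x\<in>X. prob (A x)) = (\<Sum>x\<in>X. expectation (indicator (A x)))"
    using ev by simp
  also have "\<dots> = expectation (\<lambda>\<omega>. \<Sum>x\<in>X. indicator (A x) \<omega>)"
    using ev by (subst Bochner_Integration.integral_sum) (auto simp: emeasure_eq_measure)
  also have "\<dots> \<le> expectation (\<lambda>_. real N)"
  proof (rule integral_mono)
    show "integrable M (\<lambda>\<omega>. \<Sum>x\<in>X. indicator (A x) \<omega> :: real)"
      using ev by (intro Bochner_Integration.integrable_sum) (auto simp: emeasure_eq_measure)
    fix \<omega> assume "\<omega> \<in> space M"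
    have "(\<Sum>x\<in>X. indicator (A x) \<omega>) = real (card {x \<in> X. \<omega> \<in> A x})"
      using X by (simp add: indicator_def sum.If_cases Int_def)
    then show "(\<Sum>x\<in>X. indicator (A x) \<omega>) \<le> real N"
      using mult[OF \<open>\<omega> \<in> space M\<close>] by simp
  qed simp
  also have "\<dots> = real N"
    by (simp add: prob_space)
  finally show ?thesis .
qed

lemma sends_string_dyadic_net_counting:
  assumes n: "n \<le> 2 ^ m" and T: "T * L + 1 \<le> n - 1" and B: "B \<ge> 1"
    and bw: "respects_bandwidth (dyadic_net n L) w B P"
    and far: "\<And>u v. u < v \<Longrightarrow> v - u > L \<Longrightarrow> w {u, v} \<le> 1"
    and R: "prob_space R" and \<epsilon>: "\<epsilon> < 1"
    and sends: "sends_string {..<n} (dyadic_net n L) 0 (n - 1) K \<epsilon> R P T"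
  shows "2 ^ K * (1 - \<epsilon>) \<le> 4 ^ (B * (T * m))"
proof -
  interpret prob_space R
    by (rule R)
  define X :: "bits set" where "X = {x. length x = K}"
  define A where "A = (\<lambda>x. {\<omega> \<in> space R. \<forall>v\<in>{..<n}.
    node_output (dyadic_net n L) P (source_input 0 x) \<omega> T v = (if v = n - 1 then x else [])})"
  have X: "finite X" "card X = 2 ^ K"
    using finite_lists_length_eq[of "UNIV :: bool set" K] card_lists_length_eq[of "UNIV :: bool set" K]
    by (simp_all add: X_def)
  have prob: "prob (A x) \<ge> 1 - \<epsilon>" if "x \<in> X" for x
    using sends that by (simp add: sends_string_def X_def A_def)
  \<comment> \<open>A nonmeasurable set would have measure \<open>0\<close>, contradicting success
    probability at least \<open>1 - \<epsilon> > 0\<close>.\<close>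
  have ev: "A x \<in> events" if "x \<in> X" for x
    using prob[OF that] \<epsilon> measure_notin_sets[of "A x" R] by fastforce
  have mult: "card {x \<in> X. \<omega> \<in> A x} \<le> 4 ^ (B * (T * m))" for \<omega>
  proof -
    let ?G = "{x. length x = K \<and>
                  node_output (dyadic_net n L) P (source_input 0 x) \<omega> T (n - 1) = x}"
    have "?G \<subseteq> X"
      by (auto simp: X_def)
    then have "finite ?G"
      using X(1) finite_subset by blast
    moreover have "{x \<in> X. \<omega> \<in> A x} \<subseteq> ?G"
      using T by (auto simp: X_def A_def)
    ultimately have "card {x \<in> X. \<omega> \<in> A x} \<le> card ?G"
      by (rule card_mono)
    also have "\<dots> \<le> 4 ^ (B * (T * m))"
      using n T B bw far by (rule card_decodable_inputs)
    finally show ?thesis .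
  qed
  have "2 ^ K * (1 - \<epsilon>) = (\<Sum>x\<in>X. 1 - \<epsilon>)"
    using X by simp
  also have "\<dots> \<le> (\<Sum>x\<in>X. prob (A x))"
    by (intro sum_mono prob)
  also have "\<dots> \<le> real (4 ^ (B * (T * m)))"
    by (rule sum_prob_le_if_multiplicity_le) (use X ev mult in auto)
  finally show ?thesis
    by simp
qed

text \<open>Write \<open>a\<close> for the logarithm, the number of bits lost to the error
  probability. The \<open>8\<close> collects three factors of \<open>2\<close>: from
  \<open>4 = 2 ^ 2\<close> in the count, from rounding \<open>log 2 n\<close> up, and from
  \<open>K - a \<ge> K / 2\<close> when \<open>K \<ge> 2 * a\<close>. The summand
  \<open>2 * a\<close> covers smaller \<open>K\<close>.\<close>

definition round_const :: "real \<Rightarrow> real" where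
  "round_const \<epsilon> = 1 / (8 + 2 * log 2 (1 / (1 - \<epsilon>)))"

lemma log_inverse_success_nonneg:
  fixes \<epsilon> :: real
  assumes "\<epsilon> \<in> {0..<1}"
  shows "log 2 (1 / (1 - \<epsilon>)) \<ge> 0"
  using assms by (subst zero_le_log_cancel_iff) auto

lemma round_const_pos: "\<epsilon> \<in> {0..<1} \<Longrightarrow> round_const \<epsilon> > 0"
  using log_inverse_success_nonneg[of \<epsilon>] unfolding round_const_def
  by (intro divide_pos_pos add_pos_nonneg mult_nonneg_nonneg) simp_all

lemma rounds_from_counting:
  assumes \<epsilon>: "\<epsilon> \<in> {0..<1}" and B: "B \<ge> 1" and guess: "beats_guessing K \<epsilon>"
    and l: "l \<ge> 1" and m: "real m \<le> 2 * l"
    and count: "2 ^ K * (1 - \<epsilon>) \<le> 4 ^ (B * (T * m))"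
  shows "round_const \<epsilon> * (real K / (real B * l)) \<le> real T"
proof -
  define a where "a = log 2 (1 / (1 - \<epsilon>))"
  have a: "a \<ge> 0"
    unfolding a_def using \<epsilon> by (rule log_inverse_success_nonneg)
  \<comment> \<open>Without communication the count allows only one decodable input, which is what
    \<open>beats_guessing\<close> excludes.\<close>
  have "T \<noteq> 0"
  proof
    assume "T = 0"
    then have "2 ^ K * (1 - \<epsilon>) \<le> 1"
      using count by simp
    moreover have "2 ^ K * (1 - \<epsilon>) > 1"
      using guess by (simp add: beats_guessing_def field_simps)
    ultimately show False
      by linarith
  qed
  then have T: "real T \<ge> 1"
    by simp
  have "log 2 (2 ^ K * (1 - \<epsilon>)) \<le> log 2 (4 ^ (B * (T * m)))"
    using count \<epsilon> by (subst log_le_cancel_iff) auto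
  moreover have "log 2 (2 ^ K * (1 - \<epsilon>)) = real K - a"
    using \<epsilon> by (simp add: a_def log_mult log_divide log_nat_power)
  moreover have "log 2 (4 ^ (B * (T * m))) = 2 * real (B * (T * m))"
  proof -
    have "log 2 4 = (2::real)"
      using log_nat_power[of 2 2 2] by simp
    then show ?thesis
      by (simp add: log_nat_power)
  qed
  ultimately have "real K - a \<le> 2 * real B * real T * real m"
    by simp
  also have "\<dots> \<le> 2 * real B * real T * (2 * l)"
    using m by (intro mult_left_mono) auto
  finally have K: "real K - a \<le> 4 * (real T * (real B * l))"
    by (simp add: mult_ac)
  have Bl: "real B * l \<ge> 1"
    using B l mult_mono[of 1 "real B" 1 l] by simp
  have "real K \<le> (8 + 2 * a) * (real T * (real B * l))"
  proof (cases "real K \<ge> 2 * a")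
    case True
    then have "real K \<le> 8 * (real T * (real B * l))"
      using K by linarith
    also have "\<dots> \<le> (8 + 2 * a) * (real T * (real B * l))"
      using a T Bl by (intro mult_right_mono) auto
    finally show ?thesis .
  next
    \<comment> \<open>Here \<open>K < 2 * a\<close>, and \<open>T \<ge> 1\<close> already
      suffices.\<close>
    case False
    have "1 \<le> real T * (real B * l)"
      using T Bl mult_mono[of 1 "real T" 1 "real B * l"] by simp
    then have "(8 + 2 * a) * 1 \<le> (8 + 2 * a) * (real T * (real B * l))"
      using a by (intro mult_left_mono) auto
    then show ?thesis
      using False a unfolding mult_1_right by linarith
  qed
  then have "real K / (real B * l) \<le> (8 + 2 * a) * real T"
    using Bl by (simp add: pos_divide_le_eq mult_ac)
  then have "real K / (real B * l) / (8 + 2 * a) \<le> real T"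
    using a by (subst pos_divide_le_eq) (simp_all add: mult_ac)
  then show ?thesis
    unfolding round_const_def a_def[symmetric] by (simp add: mult.commute)
qed

text \<open>Rounding up at most doubles a logarithm that is at least \<open>1\<close>.\<close>

lemma log_upper_exponent:
  assumes "n \<ge> 2"
  obtains m :: nat where "n \<le> 2 ^ m" "real m \<le> 2 * log 2 (real n)"
proof
  let ?m = "nat \<lceil>log 2 (real n)\<rceil>"
  have l: "log 2 (real n) \<ge> 1"
    using assms by simp
  have "real n = 2 powr log 2 (real n)"
    using assms by simp
  also have "\<dots> \<le> 2 powr real ?m"
    by (intro powr_mono) linarith+
  also have "\<dots> = real (2 ^ ?m)"
    by (simp add: powr_realpow)
  finally show "n \<le> 2 ^ ?m"
    by linarith
  show "real ?m \<le> 2 * log 2 (real n)"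
    using l by linarith
qed

text \<open>The parameter \<open>q\<close> stands for the number of rounds along short edges, up to
  a constant: \<open>n\<close> for the weighted graph and \<open>n / lam\<close> for the unweighted
  one. Either \<open>T\<close> is too small for short edges to reach \<open>n - 1\<close> and the
  counting bound applies, or \<open>T\<close> is at least of order \<open>n / L\<close>.\<close>

lemma sending_requires_rounds_dyadic_net:
  assumes n: "n \<ge> 2" and \<epsilon>: "\<epsilon> \<in> {0..<1}" and B: "B \<ge> 1" and guess: "beats_guessing K \<epsilon>"
    and far: "\<And>u v. u < v \<Longrightarrow> v - u > L \<Longrightarrow> w {u, v} \<le> 1"
    and q: "q * real L \<le> 2 * real n" "q \<ge> 0" and L: "L \<ge> 1"
  shows "sending_requires_rounds {..<n} (dyadic_net n L) w 0 (n - 1) B K \<epsilon>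
           (round_const \<epsilon> * min (real K / (real B * log 2 (real n))) q)"
  unfolding sending_requires_rounds_def
proof (intro allI impI, elim conjE)
  fix R P T
  assume R: "prob_space R" and bw: "respects_bandwidth (dyadic_net n L) w B P"
    and sends: "sends_string {..<n} (dyadic_net n L) 0 (n - 1) K \<epsilon> R P T"
  have c: "round_const \<epsilon> > 0"
    using \<epsilon> by (rule round_const_pos)
  show "round_const \<epsilon> * min (real K / (real B * log 2 (real n))) q \<le> real T"
  proof (cases "T * L + 1 \<le> n - 1")
    case True
    obtain m where m: "n \<le> 2 ^ m" "real m \<le> 2 * log 2 (real n)"
      using n by (rule log_upper_exponent)
    have "2 ^ K * (1 - \<epsilon>) \<le> 4 ^ (B * (T * m))"
      using m(1) True B bw far R _ sends
      by (rule sends_string_dyadic_net_counting) (use \<epsilon> in auto)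
    then have "round_const \<epsilon> * (real K / (real B * log 2 (real n))) \<le> real T"
      using \<epsilon> B guess m(2) n by (intro rounds_from_counting) auto
    moreover have "round_const \<epsilon> * min (real K / (real B * log 2 (real n))) q
        \<le> round_const \<epsilon> * (real K / (real B * log 2 (real n)))"
      using c by (intro mult_left_mono) auto
    ultimately show ?thesis
      by linarith
  next
    case False
    \<comment> \<open>Here \<open>T * L \<ge> n - 1\<close>, and \<open>n \<le> 2 * (n - 1)\<close>
      because \<open>n \<ge> 2\<close>.\<close>
    then have "n \<le> 2 * (T * L)"
      using n by linarith
    then have "real n \<le> 2 * (real T * real L)"
      by (metis of_nat_le_iff of_nat_mult of_nat_numeral)
    then have "q * real L \<le> (4 * real T) * real L"
      using q by linarith
    then have "q \<le> 4 * real T"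
      using L by simp
    moreover have "round_const \<epsilon> \<le> 1 / 8"
      unfolding round_const_def using log_inverse_success_nonneg[OF \<epsilon>]
      by (intro divide_left_mono) auto
    then have "round_const \<epsilon> * q \<le> 1 / 8 * q"
      using q(2) by (rule mult_right_mono)
    moreover have "round_const \<epsilon> * min (real K / (real B * log 2 (real n))) q \<le> round_const \<epsilon> * q"
      using c by (intro mult_left_mono) auto
    ultimately show ?thesis
      by linarith
  qed
qed

lemma hop_diameter_dyadic_net_log:
  assumes "n \<ge> 2"
  obtains D where "hop_diameter {..<n} (dyadic_net n L) = enat D"
    "real D \<le> 4 * log 2 (real n)"
proof -
  obtain m where m: "n \<le> 2 ^ m" "real m \<le> 2 * log 2 (real n)"
    using assms by (rule log_upper_exponent)
  have le: "hop_diameter {..<n} (dyadic_net n L) \<le> enat (2 * m)"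
    using m(1) by (rule hop_diameter_dyadic_net)
  then obtain D where D: "hop_diameter {..<n} (dyadic_net n L) = enat D"
    by (cases "hop_diameter {..<n} (dyadic_net n L)") auto
  then have "real D \<le> 4 * log 2 (real n)"
    using le m(2) by simp
  with D that show ?thesis
    by blast
qed

theorem theoremD1:
  "\<exists>C c. C > 0 \<and> (\<forall>\<epsilon>\<in>{0..<1}. c \<epsilon> > 0) \<and>
     (\<forall>(lam::real) (n::nat). lam \<ge> 1 \<longrightarrow> n \<ge> 2 \<longrightarrow>
        (\<exists>(V::nat set) E w s t D.
           simple_graph V E \<and> card V = n \<and> (\<forall>e\<in>E. w e \<ge> 1 \<and> w e \<in> \<nat>) \<and>
           edge_connectivity V E w \<ge> lam \<and>
           hop_diameter V E = enat D \<and> real D \<le> C * log 2 (real n) \<and>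
           s \<in> V \<and> t \<in> V \<and> s \<noteq> t \<and>
           (\<forall>\<epsilon>\<in>{0..<1}. \<forall>K B. B \<ge> 1 \<longrightarrow> beats_guessing K \<epsilon> \<longrightarrow>
              sending_requires_rounds V E w s t B K \<epsilon>
                (c \<epsilon> * min (real K / (real B * log 2 (real n))) (real n))))) \<and>
     (\<forall>(lam::real) (n::nat). lam \<ge> 1 \<longrightarrow> real n \<ge> lam + 1 \<longrightarrow>
        (\<exists>(V::nat set) E s t D.
           simple_graph V E \<and> card V = n \<and>
           edge_connectivity V E (\<lambda>_. 1) \<ge> lam \<and>
           hop_diameter V E = enat D \<and> real D \<le> C * log 2 (real n) \<and>
           s \<in> V \<and> t \<in> V \<and> s \<noteq> t \<and>
           (\<forall>\<epsilon>\<in>{0..<1}. \<forall>K B. B \<ge> 1 \<longrightarrow> beats_guessing K \<epsilon> \<longrightarrow>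
              sending_requires_rounds V E (\<lambda>_. 1) s t B K \<epsilon>
                (c \<epsilon> * min (real K / (real B * log 2 (real n))) (real n / lam)))))"
\<comment> \<open>The \<open>4\<close> is a factor \<open>2\<close> for the detour through
  \<open>0\<close> times a factor \<open>2\<close> for rounding the logarithm.\<close>
proof (rule exI[of _ 4], rule exI[of _ round_const], intro conjI allI impI ballI)
  show "(4::real) > 0"
    by simp
next
  fix \<epsilon> :: real assume "\<epsilon> \<in> {0..<1}"
  then show "round_const \<epsilon> > 0"
    by (rule round_const_pos)
next
  fix lam :: real and n :: nat
  assume lam: "lam \<ge> 1" and n: "n \<ge> 2"
  \<comment> \<open>Rounding up keeps the weights integral, so they can be read as edge
    multiplicities. Only path edges become heavy; longer shortcuts keep weight \<open>1\<close> and
    so carry only \<open>B\<close> bits.\<close>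
  define W where "W = nat \<lceil>lam\<rceil>"
  define w :: "nat set \<Rightarrow> real" where "w = (\<lambda>e. if \<exists>u. e = {u, Suc u} then real W else 1)"
  have W: "real W \<ge> lam" "real W \<ge> 1"
    using lam unfolding W_def by linarith+
  have near: "w {u, v} \<ge> real W" if "u < v" "v - u \<le> 1" for u v
  proof -
    have "v = Suc u"
      using that by linarith
    then show ?thesis
      by (auto simp: w_def)
  qed
  have far: "w {u, v} \<le> 1" if "u < v" "v - u > 1" for u v
    using that by (auto simp: w_def doubleton_eq_iff)
  obtain D where D: "hop_diameter {..<n} (dyadic_net n 1) = enat D" "real D \<le> 4 * log 2 (real n)"
    using n by (rule hop_diameter_dyadic_net_log)
  have "edge_connectivity {..<n} (dyadic_net n 1) w \<ge> real 1 * real W"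
    using n near W by (intro edge_connectivity_dyadic_net) (auto simp: w_def)
  then have "edge_connectivity {..<n} (dyadic_net n 1) w \<ge> lam"
    using W by simp
  moreover have "sending_requires_rounds {..<n} (dyadic_net n 1) w 0 (n - 1) B K \<epsilon>
      (round_const \<epsilon> * min (real K / (real B * log 2 (real n))) (real n))"
    if "\<epsilon> \<in> {0..<1}" "B \<ge> 1" "beats_guessing K \<epsilon>" for \<epsilon> K B
    using n that far by (intro sending_requires_rounds_dyadic_net) auto
  moreover have "\<forall>e\<in>dyadic_net n 1. w e \<ge> 1 \<and> w e \<in> \<nat>"
    using W by (auto simp: w_def)
  ultimately show "\<exists>(V::nat set) E w s t D.
           simple_graph V E \<and> card V = n \<and> (\<forall>e\<in>E. w e \<ge> 1 \<and> w e \<in> \<nat>) \<and>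
           edge_connectivity V E w \<ge> lam \<and>
           hop_diameter V E = enat D \<and> real D \<le> 4 * log 2 (real n) \<and>
           s \<in> V \<and> t \<in> V \<and> s \<noteq> t \<and>
           (\<forall>\<epsilon>\<in>{0..<1}. \<forall>K B. B \<ge> 1 \<longrightarrow> beats_guessing K \<epsilon> \<longrightarrow>
              sending_requires_rounds V E w s t B K \<epsilon>
                (round_const \<epsilon> * min (real K / (real B * log 2 (real n))) (real n)))"
    using n D simple_graph_dyadic_net[of n 1]
    by (intro exI[of _ "{..<n}"] exI[of _ "dyadic_net n 1"] exI[of _ w] exI[of _ 0]
        exI[of _ "n - 1"] exI[of _ D]) auto
next
  fix lam :: real and n :: nat
  assume lam: "lam \<ge> 1" and n_lam: "real n \<ge> lam + 1"
  define L where "L = nat \<lceil>lam\<rceil>"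
  \<comment> \<open>Since \<open>lam \<ge> 1\<close>, rounding up costs at most a factor
    \<open>2\<close>, which is the slack allowed in the condition
    \<open>q * real L \<le> 2 * real n\<close>.\<close>
  have L: "real L \<ge> lam" "L \<ge> 1" "real L \<le> 2 * lam"
    using lam unfolding L_def by linarith+
  have n: "n \<ge> 2" "L + 1 \<le> n"
    using lam n_lam unfolding L_def by linarith+
  obtain D where D: "hop_diameter {..<n} (dyadic_net n L) = enat D" "real D \<le> 4 * log 2 (real n)"
    using n(1) by (rule hop_diameter_dyadic_net_log)
  have "edge_connectivity {..<n} (dyadic_net n L) (\<lambda>_. 1) \<ge> real L * 1"
    using n L by (intro edge_connectivity_dyadic_net) auto
  then have "edge_connectivity {..<n} (dyadic_net n L) (\<lambda>_. 1) \<ge> lam"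
    using L by simp
  moreover have "real n / lam * real L \<le> 2 * real n"
  proof -
    have "real n / lam * real L \<le> real n / lam * (2 * lam)"
      using L lam by (intro mult_left_mono) auto
    then show ?thesis
      using lam by simp
  qed
  then have "sending_requires_rounds {..<n} (dyadic_net n L) (\<lambda>_. 1) 0 (n - 1) B K \<epsilon>
      (round_const \<epsilon> * min (real K / (real B * log 2 (real n))) (real n / lam))"
    if "\<epsilon> \<in> {0..<1}" "B \<ge> 1" "beats_guessing K \<epsilon>" for \<epsilon> K B
    using n L lam that by (intro sending_requires_rounds_dyadic_net) auto
  ultimately show "\<exists>(V::nat set) E s t D.
           simple_graph V E \<and> card V = n \<and>
           edge_connectivity V E (\<lambda>_. 1) \<ge> lam \<and>
           hop_diameter V E = enat D \<and> real D \<le> 4 * log 2 (real n) \<and>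
           s \<in> V \<and> t \<in> V \<and> s \<noteq> t \<and>
           (\<forall>\<epsilon>\<in>{0..<1}. \<forall>K B. B \<ge> 1 \<longrightarrow> beats_guessing K \<epsilon> \<longrightarrow>
              sending_requires_rounds V E (\<lambda>_. 1) s t B K \<epsilon>
                (round_const \<epsilon> * min (real K / (real B * log 2 (real n))) (real n / lam)))"
    using n D simple_graph_dyadic_net[of n L]
    by (intro exI[of _ "{..<n}"] exI[of _ "dyadic_net n L"] exI[of _ 0]
        exI[of _ "n - 1"] exI[of _ D]) auto
qed

end
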